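(* Let $\theta\in(0,2)$. Let $W$ be the set of all $x\in[0,1]$ such that none of the frequencies $\nu_0(x),\nu_1(x),\nu_2(x)$ of ternary digits exists, while the asymptotic mean value $r(x)$ of the ternary digits exists and equals $\theta$. Then $W$ has the cardinality of the continuum and is dense in $[0,1]$.
   Context: Every $x\in[0,1]$ has a ternary representation $x=\sum_{k\ge 1}\alpha_k 3^{-k}$ with $\alpha_k\in\{0,1,2\}$. If $x$ has two such representations, the one ending in zeros (period $(0)$) is used; the number $1$ has only the representation with all digits equal to $2$. Thus the $k$-th digit $\alpha_k(x)$ is well defined. For $i\in\{0,1,2\}$ put $N_i(x,k)=\#\{j\le k:\alpha_j(x)=i\}$. The frequency of digit $i$ in $x$ is $\nu_i(x)=\lim_{k\to\infty}N_i(x,k)/k$, if this limit exists (otherwise the frequency is said not to exist). The asymptotic mean value of the digits of $x$ is $r(x)=\lim_{n\to\infty}\frac1n\sum_{i=1}^n\alpha_i(x)$, if this limit exists. *)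

theory Defs
  imports "HOL-Analysis.Analysis" "HOL-Library.Equipollence"
begin

text \<open>Digit positions start at 1; the value of a digit sequence at 0 is irrelevant.\<close>

definition ternary_rep :: "(nat \<Rightarrow> nat) \<Rightarrow> real \<Rightarrow> bool" where
  "ternary_rep a x \<longleftrightarrow>
     (\<forall>k\<ge>1. a k \<in> {0, 1, 2}) \<and> (\<lambda>k. real (a (Suc k)) / 3 ^ Suc k) sums x"

definition ends_in_zeros :: "(nat \<Rightarrow> nat) \<Rightarrow> bool" where
  "ends_in_zeros a \<longleftrightarrow> (\<exists>n. \<forall>k\<ge>n. a k = 0)"

definition canonical_ternary_rep :: "(nat \<Rightarrow> nat) \<Rightarrow> real \<Rightarrow> bool" where
  "canonical_ternary_rep a x \<longleftrightarrow>
     ternary_rep a x \<and>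
     ((\<exists>b. ternary_rep b x \<and> (\<exists>k\<ge>1. b k \<noteq> a k)) \<longrightarrow> ends_in_zeros a)"

text \<open>Meaningful for \<open>x \<in> {0..1}\<close> and \<open>k \<ge> 1\<close>, where the digit is unique.\<close>

definition ternary_digit :: "real \<Rightarrow> nat \<Rightarrow> nat" where
  "ternary_digit x k = (THE d. \<exists>a. canonical_ternary_rep a x \<and> a k = d)"

definition digit_count :: "nat \<Rightarrow> real \<Rightarrow> nat \<Rightarrow> nat" where
  "digit_count i x k = card {j \<in> {1..k}. ternary_digit x j = i}"

definition has_digit_frequency :: "nat \<Rightarrow> real \<Rightarrow> real \<Rightarrow> bool" where
  "has_digit_frequency i x v \<longleftrightarrow>
     (\<lambda>k. real (digit_count i x k) / real k) \<longlonglongrightarrow> v"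

definition has_digit_mean :: "real \<Rightarrow> real \<Rightarrow> bool" where
  "has_digit_mean x r \<longleftrightarrow>
     (\<lambda>n. (\<Sum>i=1..n. real (ternary_digit x i)) / real n) \<longlonglongrightarrow> r"

definition no_freq_mean_set :: "real \<Rightarrow> real set" where
  "no_freq_mean_set \<theta> =
     {x \<in> {0..1}. (\<forall>i\<in>{0, 1, 2}. \<nexists>v. has_digit_frequency i x v) \<and> has_digit_mean x \<theta>}"

end

theory Submission
  imports Defs "HOL-Real_Asymp.Real_Asymp"
begin

text \<open>
  Digits are chosen greedily: the next digit is above \<open>\<theta>\<close> or below \<open>\<theta>\<close> according to whether the
  digit sum so far lags behind or exceeds \<open>n * \<theta>\<close>. This keeps the deviation bounded, hence the mean
  is \<open>\<theta>\<close>, whichever pair of digits is used. Alternating over blocks of geometrically growing length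
  between the pair \<open>{0, 2}\<close> and a pair containing \<open>1\<close> (\<open>{0, 1}\<close> or \<open>{1, 2}\<close>) makes the frequency of
  \<open>1\<close> oscillate. Since \<open>N\<^sub>0 + N\<^sub>1 + N\<^sub>2 = n\<close> and \<open>N\<^sub>1 + 2 * N\<^sub>2 = n * \<theta> + o(n)\<close>, a limit frequency of
  any one digit would give one for \<open>1\<close>, so no frequency exists. The digits on a set of
  positions of density zero may be prescribed: prescribing a finite prefix gives density of the set
  in the interval, prescribing the digits at square positions gives an injection from the sets of
  natural numbers.
\<close>

section \<open>Ternary representations: uniqueness, existence and truncation\<close>

lemma ternary_weights_sums: "(\<lambda>j. 2 / 3 ^ Suc (j + m)) sums (1 / 3 ^ m :: real)"
proof -
  have "(\<lambda>j. (2 / 3 ^ Suc m) * (1 / 3) ^ j) sums ((2 / 3 ^ Suc m) * (1 / (1 - 1 / 3)) :: real)"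
    by (intro sums_mult geometric_sums) simp
  then show ?thesis
    by (simp add: power_add power_one_over field_simps)
qed

lemma ternary_digit_le_2: "ternary_rep a x \<Longrightarrow> a (Suc k) \<le> 2"
  by (auto simp: ternary_rep_def dest!: spec[of _ "Suc k"])

text \<open>A deficit of at least one unit at position \<open>Suc m\<close> equals at most the value
  of the all-twos tail, so the later digits can make it up only by differing by the maximal amount 2
  everywhere.\<close>

lemma ternary_rep_first_difference:
  assumes a: "ternary_rep a x" and b: "ternary_rep b x"
    and eq: "\<And>j. j < m \<Longrightarrow> a (Suc j) = b (Suc j)" and less: "a (Suc m) < b (Suc m)"
  shows "a (Suc (j + Suc m)) = 2 \<and> b (Suc (j + Suc m)) = 0"
proof -
  define f where "f j = (real (a (Suc j)) - real (b (Suc j))) / 3 ^ Suc j" for j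
  \<comment> \<open>\<open>g\<close> measures how far each tail term falls short of the maximal
    difference 2. Its terms are nonnegative while its sum turns out to be at most 0, so all of them
    vanish.\<close>
  define g where "g j = 2 / 3 ^ Suc (j + Suc m) - f (j + Suc m)" for j
  have "f sums (x - x)"
    unfolding f_def diff_divide_distrib using a b by (intro sums_diff) (auto simp: ternary_rep_def)
  then have "(\<lambda>j. f (j + Suc m)) sums (0 - (\<Sum>i<Suc m. f i))"
    using sums_split_initial_segment[of f 0 "Suc m"] by simp
  moreover have "(\<Sum>i<Suc m. f i) = f m"
    using eq by (simp add: f_def)
  ultimately have g: "g sums (1 / 3 ^ Suc m + f m)"
    using sums_diff[OF ternary_weights_sums[of "Suc m"]] unfolding g_def by fastforce
  have g_eq: "g j = (2 - real (a (Suc (j + Suc m))) + real (b (Suc (j + Suc m)))) / 3 ^ Suc (j + Suc m)" for j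
    by (simp add: g_def f_def field_simps)
  have nonneg: "0 \<le> g j" for j
    unfolding g_eq using ternary_digit_le_2[OF a, of "j + Suc m"] by (intro divide_nonneg_pos) auto
  have "1 / 3 ^ Suc m + f m = (1 + real (a (Suc m)) - real (b (Suc m))) / 3 ^ Suc m"
    by (simp add: f_def field_simps)
  also have "\<dots> \<le> 0"
    using less by (intro divide_nonpos_pos) auto
  finally have "suminf g = 0"
    using g nonneg suminf_nonneg[of g] by (simp add: sums_iff)
  then have "g j = 0"
    using suminf_eq_zero_iff[of g] g nonneg by (auto simp: sums_iff)
  then show ?thesis
    using ternary_digit_le_2[OF a, of "j + Suc m"] by (auto simp: g_eq)
qed

lemma ternary_rep_unique:
  assumes a: "ternary_rep a x" and b: "ternary_rep b x"
    and no_zeros: "\<not> (\<exists>n. \<forall>k\<ge>n. a k = 0)" and no_twos: "\<not> (\<exists>n. \<forall>k\<ge>n. a k = 2)"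
  shows "a (Suc k) = b (Suc k)"
proof (rule ccontr)
  assume "a (Suc k) \<noteq> b (Suc k)"
  define m where "m = (LEAST k. a (Suc k) \<noteq> b (Suc k))"
  have neq: "a (Suc m) \<noteq> b (Suc m)"
    unfolding m_def by (rule LeastI) fact
  have eq: "a (Suc j) = b (Suc j)" if "j < m" for j
    using not_less_Least[OF that[unfolded m_def]] by blast
  have shift: "\<exists>i. j = Suc (i + Suc m)" if "j \<ge> Suc (Suc m)" for j
    using that by (metis add.commute add_Suc_right add_Suc le_Suc_ex)
  show False
  proof (cases "a (Suc m) < b (Suc m)")
    case True
    then have "\<forall>j\<ge>Suc (Suc m). a j = 2"
      using ternary_rep_first_difference[OF a b eq] shift by metis
    then show False using no_twos by blast
  next
    case False
    then have "\<forall>j\<ge>Suc (Suc m). a j = 0"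
      using ternary_rep_first_difference[OF b a eq[symmetric]] shift neq by (metis linorder_neqE_nat)
    then show False using no_zeros by blast
  qed
qed

text \<open>Without a rival representation the canonicity condition holds vacuously, so
  \<open>THE\<close> selects the digit of \<open>a\<close>.\<close>

lemma ternary_digit_eqI:
  assumes a: "ternary_rep a x"
    and no_zeros: "\<not> (\<exists>n. \<forall>k\<ge>n. a k = 0)" and no_twos: "\<not> (\<exists>n. \<forall>k\<ge>n. a k = 2)"
    and "1 \<le> k"
  shows "ternary_digit x k = a k"
proof -
  have unique: "b k = a k" if "ternary_rep b x" "1 \<le> k" for b k
    using ternary_rep_unique[OF a that(1) no_zeros no_twos, of "k - 1"] that(2) by simp
  then have "canonical_ternary_rep a x"
    using a by (auto simp: canonical_ternary_rep_def)
  then show ?thesis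
    unfolding ternary_digit_def
    using unique \<open>1 \<le> k\<close> by (intro the_equality) (auto simp: canonical_ternary_rep_def)
qed

lemma ternary_rep_exists:
  assumes "\<And>k. a k \<le> 2"
  obtains x where "ternary_rep a x" "x \<in> {0..1}"
proof -
  define f where "f k = real (a (Suc k)) / 3 ^ Suc k" for k
  have le: "f k \<le> 2 / 3 ^ Suc (k + 0)" and nonneg: "0 \<le> f k" for k
    using assms[of "Suc k"] by (auto simp: f_def intro!: divide_right_mono)
  have "summable f"
    using le nonneg by (intro summable_comparison_test'[OF sums_summable[OF ternary_weights_sums[of 0]], of 0]) auto
  then have f: "f sums suminf f"
    by (rule summable_sums)
  have "suminf f \<le> 1"
    using sums_le[OF le f ternary_weights_sums] by simp
  moreover have "0 \<le> suminf f"
    using \<open>summable f\<close> nonneg by (rule suminf_nonneg)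
  moreover have "a k \<in> {0, 1, 2}" for k
    using assms[of k] by auto
  ultimately show thesis
    using f that[of "suminf f"] by (auto simp: ternary_rep_def f_def[abs_def])
qed

text \<open>The digits are the jumps of \<open>\<lfloor>3 ^ k * x\<rfloor>\<close> under tripling,
  so the partial sums telescope; \<open>x < 1\<close> makes the starting value
  \<open>\<lfloor>x\<rfloor>\<close> vanish.\<close>

lemma ternary_expansion_prefix:
  fixes x :: real
  assumes "0 \<le> x" "x < 1"
  shows "\<exists>p :: nat \<Rightarrow> nat. (\<forall>k. p k \<le> 2) \<and>
    (\<forall>n. (\<Sum>k<n. real (p (Suc k)) / 3 ^ Suc k) = \<lfloor>3 ^ n * x\<rfloor> / 3 ^ n)"
proof -
  define d where "d k = \<lfloor>3 ^ k * x\<rfloor> - 3 * \<lfloor>3 ^ (k - 1) * x\<rfloor>" for k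
  have d: "0 \<le> d (Suc k)" "d (Suc k) \<le> 2" for k
    by (auto simp: d_def) linarith+
  have eq: "(\<Sum>k<n. real (nat (d (Suc k))) / 3 ^ Suc k) = \<lfloor>3 ^ n * x\<rfloor> / 3 ^ n" for n
  proof (induction n)
    case 0
    have "\<lfloor>x\<rfloor> = 0" using assms by linarith
    then show ?case by simp
  next
    case (Suc n)
    have "real (nat (d (Suc n))) = real_of_int (d (Suc n))"
      using d(1)[of n] by simp
    then show ?case
      unfolding sum.lessThan_Suc Suc by (simp add: d_def field_simps)
  qed
  show ?thesis
    \<comment> \<open>The cap at 2 changes no digit at positions from 1 on; it supplies the bound at
      index 0, which the facts about \<open>d (Suc k)\<close> do not cover.\<close>
    by (rule exI[of _ "\<lambda>k. nat (min 2 (d k))"]) (use d eq in \<open>auto simp: min_absorb2\<close>)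
qed

text \<open>The tail lies between 0 and the all-twos tail, whose value is
  \<open>1 / 3 ^ n\<close>.\<close>

lemma ternary_prefix_dist:
  assumes "ternary_rep a x"
  shows "\<bar>x - (\<Sum>k<n. real (a (Suc k)) / 3 ^ Suc k)\<bar> \<le> 1 / 3 ^ n"
proof -
  define f where "f k = real (a (Suc k)) / 3 ^ Suc k" for k
  have "f sums x"
    using assms by (simp add: ternary_rep_def f_def[abs_def])
  then have sums: "(\<lambda>k. f (k + n)) sums (x - (\<Sum>k<n. f k))"
    by (rule sums_split_initial_segment)
  have "f (k + n) \<le> 2 / 3 ^ Suc (k + n)" "0 \<le> f (k + n)" for k
    using ternary_digit_le_2[OF assms, of "k + n"] by (auto simp: f_def intro!: divide_right_mono)
  then have "0 \<le> x - (\<Sum>k<n. f k)" "x - (\<Sum>k<n. f k) \<le> 1 / 3 ^ n"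
    using sums_le[OF _ sums_zero sums] sums_le[OF _ sums ternary_weights_sums[of n]] by auto
  then show ?thesis
    by (simp add: f_def)
qed

section \<open>Counting along initial segments and the greedy digit sequence\<close>

definition count_upto :: "(nat \<Rightarrow> bool) \<Rightarrow> nat \<Rightarrow> nat" where
  "count_upto P n = card {j \<in> {1..n}. P j}"

lemma count_upto_0 [simp]: "count_upto P 0 = 0"
  by (simp add: count_upto_def)

lemma count_upto_Suc [simp]: "count_upto P (Suc n) = count_upto P n + (if P (Suc n) then 1 else 0)"
proof -
  have "{j \<in> {1..Suc n}. P j} = (if P (Suc n) then {Suc n} else {}) \<union> {j \<in> {1..n}. P j}"
    by (auto simp: le_Suc_eq)
  then show ?thesis
    by (simp add: count_upto_def)
qed

lemma count_upto_mono: "m \<le> n \<Longrightarrow> count_upto P m \<le> count_upto P n"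
  unfolding count_upto_def by (rule card_mono) auto

lemma count_upto_cong: "(\<And>j. 1 \<le> j \<Longrightarrow> P j = Q j) \<Longrightarrow> count_upto P n = count_upto Q n"
  unfolding count_upto_def by (rule arg_cong[where f = card]) auto

text \<open>\<open>F\<close> is the set of prescribed positions and \<open>p\<close> gives the digits there.\<close>

locale steered_digits =
  fixes \<theta> :: real and F :: "nat set" and p :: "nat \<Rightarrow> nat" and N :: nat
  assumes \<theta>_pos: "0 < \<theta>" and \<theta>_less_2: "\<theta> < 2"
    and p_le_2: "p n \<le> 2" and p_neq_1: "N < n \<Longrightarrow> n \<in> F \<Longrightarrow> p n \<noteq> 1"
    and F_sparse: "(\<lambda>n. real (count_upto (\<lambda>j. j \<in> F) n) / real n) \<longlonglongrightarrow> 0"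
begin

abbreviation cF :: "nat \<Rightarrow> nat" where "cF \<equiv> count_upto (\<lambda>j. j \<in> F)"

text \<open>For either value of \<open>u\<close>, \<open>low u < \<theta>\<close> and
  \<open>\<theta> \<le> high u\<close>, so both pairs can steer. The flag \<open>u\<close> replaces
  the pair 0, 2 by two consecutive digits enclosing \<theta>.\<close>

definition low :: "bool \<Rightarrow> nat" where "low u = (if u \<and> 1 < \<theta> then 1 else 0)"
definition high :: "bool \<Rightarrow> nat" where "high u = (if u \<and> \<theta> \<le> 1 then 1 else 2)"

text \<open>Phases and the gaps between them each double the length of the prefix, so each has a
  positive share of all positions up to its end.\<close>

definition ones_phase :: "nat \<Rightarrow> bool" where
  "ones_phase n \<longleftrightarrow> (\<exists>m. 4 ^ m < n \<and> n \<le> 2 * 4 ^ m)"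

text \<open>The recursion runs on the digit sum because the greedy rule compares it with
  \<open>\<theta> * real n\<close>; the digits are recovered as increments.\<close>

primrec S :: "nat \<Rightarrow> nat" where
  "S 0 = 0"
| "S (Suc n) = S n +
     (if Suc n \<in> F then p (Suc n)
      else if real (S n) \<le> \<theta> * real n then high (ones_phase (Suc n)) else low (ones_phase (Suc n)))"

definition digit :: "nat \<Rightarrow> nat" where "digit n = S n - S (n - 1)"

lemma digit_Suc:
  "digit (Suc n) =
     (if Suc n \<in> F then p (Suc n)
      else if real (S n) \<le> \<theta> * real n then high (ones_phase (Suc n)) else low (ones_phase (Suc n)))"
  by (simp add: digit_def)

lemma S_Suc: "S (Suc n) = S n + digit (Suc n)"
  by (simp add: digit_def)

lemma digit_le_2: "digit n \<le> 2"
  by (cases n) (use p_le_2 in \<open>auto simp: digit_Suc low_def high_def\<close>, simp add: digit_def)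

lemma digit_free: "1 \<le> n \<Longrightarrow> n \<in> F \<Longrightarrow> digit n = p n"
  by (cases n) (auto simp: digit_Suc)

lemma S_eq_sum: "S n = (\<Sum>i=1..n. digit i)"
  by (induction n) (simp_all add: S_Suc del: S.simps(2))

text \<open>A free digit moves the deviation towards or across 0 by at most 2, so it cannot break
  the bound. A prescribed digit may push it outwards by at most 2, which is paid for by the growth
  of \<open>cF\<close>.\<close>

lemma S_deviation: "\<bar>real (S n) - \<theta> * real n\<bar> \<le> 2 + 2 * real (cF n)"
proof (induction n)
  case (Suc n)
  have d: "real (digit (Suc n)) \<le> 2" "0 \<le> real (digit (Suc n))"
    using digit_le_2[of "Suc n"] by auto
  have step: "real (S (Suc n)) - \<theta> * real (Suc n) = (real (S n) - \<theta> * real n) + (real (digit (Suc n)) - \<theta>)"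
    by (simp add: S_Suc algebra_simps del: S.simps(2))
  show ?case
  proof (cases "Suc n \<in> F")
    case True
    then show ?thesis
      unfolding step using Suc.IH d \<theta>_pos \<theta>_less_2 by simp
  next
    case False
    show ?thesis
    proof (cases "real (S n) \<le> \<theta> * real n")
      case True
      then have "\<theta> \<le> real (digit (Suc n))"
        using False \<theta>_less_2 by (auto simp: digit_Suc high_def)
      then show ?thesis
        unfolding step using Suc.IH d \<theta>_pos True by simp
    next
      case gt: False
      then have "real (digit (Suc n)) \<le> \<theta>"
        using False \<theta>_pos by (auto simp: digit_Suc low_def)
      then show ?thesis
        unfolding step using Suc.IH d \<theta>_less_2 gt False by simp
    qed
  qed
qed simp

lemma mean_limit: "(\<lambda>n. real (S n) / real n) \<longlonglongrightarrow> \<theta>"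
proof -
  have "(\<lambda>n. 2 / real n + 2 * (real (cF n) / real n)) \<longlonglongrightarrow> 0 + 2 * 0"
    by (intro tendsto_intros F_sparse)
  then have bound: "(\<lambda>n. 2 / real n + 2 * (real (cF n) / real n)) \<longlonglongrightarrow> 0"
    by simp
  have "(\<lambda>n. real (S n) / real n - \<theta>) \<longlonglongrightarrow> 0"
  proof (rule Lim_null_comparison[OF _ bound])
    show "\<forall>\<^sub>F n in sequentially. norm (real (S n) / real n - \<theta>) \<le> 2 / real n + 2 * (real (cF n) / real n)"
      using eventually_gt_at_top[of 0]
    proof eventually_elim
      case (elim n)
      have "real (S n) / real n - \<theta> = (real (S n) - \<theta> * real n) / real n"
        using elim by (simp add: diff_divide_distrib)
      then have "norm (real (S n) / real n - \<theta>) = \<bar>real (S n) - \<theta> * real n\<bar> / real n"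
        by simp
      also have "\<dots> \<le> (2 + 2 * real (cF n)) / real n"
        by (intro divide_right_mono S_deviation) simp
      finally show ?case by (simp add: add_divide_distrib)
    qed
  qed
  then show ?thesis by (rule LIM_zero_cancel)
qed

section \<open>Digit counts and the divergence of all frequencies\<close>

abbreviation c :: "nat \<Rightarrow> nat \<Rightarrow> nat" where "c i \<equiv> count_upto (\<lambda>j. digit j = i)"

lemma count_total: "c 0 n + c 1 n + c 2 n = n"
proof (induction n)
  case (Suc n)
  then show ?case using digit_le_2[of "Suc n"] by auto
qed simp

lemma count_weighted: "c 1 n + 2 * c 2 n = S n"
proof (induction n)
  case (Suc n)
  then show ?case using digit_le_2[of "Suc n"] by (auto simp: S_Suc simp del: S.simps(2))
qed simp

lemma ones_constant:
  assumes "m \<le> n" "\<And>j. m < j \<Longrightarrow> j \<le> n \<Longrightarrow> digit j \<noteq> 1"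
  shows "c 1 n = c 1 m"
  using assms
proof (induction n rule: dec_induct)
  case (step k)
  then show ?case using step.prems[of "Suc k"] by simp
qed simp

lemma no_ones_outside_phase:
  assumes "N < j" "\<not> ones_phase j"
  shows "digit j \<noteq> 1"
  using assms p_neq_1 by (cases j) (auto simp: digit_Suc low_def high_def)

text \<open>In such a phase free digits are 0 or 1, so the growth of \<open>S\<close> counts ones,
  up to 2 for each prescribed position. The additive form avoids truncated subtraction.\<close>

lemma ones_lower_le_1:
  assumes "\<theta> \<le> 1" "m \<le> n" "\<And>j. m < j \<Longrightarrow> j \<le> n \<Longrightarrow> ones_phase j"
  shows "S n + c 1 m + 2 * cF m \<le> S m + c 1 n + 2 * cF n"
  using assms(2,3)
proof (induction n rule: dec_induct)
  case (step k)
  have "digit (Suc k) \<le> (if digit (Suc k) = 1 then 1 else 0) + 2 * (if Suc k \<in> F then 1 else 0)"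
    using step.prems[of "Suc k"] step.hyps p_le_2[of "Suc k"] \<open>\<theta> \<le> 1\<close>
    by (auto simp: digit_Suc low_def high_def)
  then show ?case
    using step.IH step.prems by (fastforce simp: S_Suc simp del: S.simps(2))
qed simp

text \<open>Here free digits are 1 or 2, so ones are counted by the shortfall of the digit sum from
  2 per position.\<close>

lemma ones_lower_gt_1:
  assumes "1 < \<theta>" "m \<le> n" "\<And>j. m < j \<Longrightarrow> j \<le> n \<Longrightarrow> ones_phase j"
  shows "2 * n + S m + c 1 m + 2 * cF m \<le> 2 * m + S n + c 1 n + 2 * cF n"
  using assms(2,3)
proof (induction n rule: dec_induct)
  case (step k)
  have "2 \<le> digit (Suc k) + (if digit (Suc k) = 1 then 1 else 0) + 2 * (if Suc k \<in> F then 1 else 0)"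
    using step.prems[of "Suc k"] step.hyps \<open>1 < \<theta>\<close>
    by (auto simp: digit_Suc low_def high_def)
  then show ?case
    using step.IH step.prems by (fastforce simp: S_Suc simp del: S.simps(2))
qed simp

text \<open>\<open>S\<close> grows at rate \<theta>, so a phase has ones at rate about \<theta> or
  \<open>2 - \<theta>\<close>; the minimum is the relevant one in each case. The error terms collect
  the deviation bounds at \<open>m\<close> and \<open>n\<close> and \<open>2 * cF n\<close> for
  prescribed digits.\<close>

lemma ones_lower:
  assumes "m \<le> n" "\<And>j. m < j \<Longrightarrow> j \<le> n \<Longrightarrow> ones_phase j"
  shows "min \<theta> (2 - \<theta>) * real (n - m) \<le> real (c 1 n) + 6 * real (cF n) + 4"
proof -
  have dev: "\<bar>real (S n) - \<theta> * real n\<bar> \<le> 2 + 2 * real (cF n)" "\<bar>real (S m) - \<theta> * real m\<bar> \<le> 2 + 2 * real (cF n)"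
    using S_deviation[of n] S_deviation[of m] count_upto_mono[OF assms(1), of "\<lambda>j. j \<in> F"] by auto
  show ?thesis
  proof (cases "\<theta> \<le> 1")
    case True
    have "real (S n + c 1 m + 2 * cF m) \<le> real (S m + c 1 n + 2 * cF n)"
      using ones_lower_le_1[OF True assms] of_nat_mono by blast
    then have "real (S n) - real (S m) \<le> real (c 1 n) + 2 * real (cF n)"
      by simp
    then show ?thesis
      using dev True assms(1) by (simp add: of_nat_diff right_diff_distrib min_def)
  next
    case False
    have "real (2 * n + S m + c 1 m + 2 * cF m) \<le> real (2 * m + S n + c 1 n + 2 * cF n)"
      using ones_lower_gt_1[OF _ assms] False of_nat_mono by (meson not_le)
    then have "2 * real n - 2 * real m - (real (S n) - real (S m)) \<le> real (c 1 n) + 2 * real (cF n)"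
      by simp
    then show ?thesis
      using dev False assms(1) by (simp add: of_nat_diff right_diff_distrib left_diff_distrib min_def)
  qed
qed

text \<open>Doubling \<open>n = 2 * 4 ^ m\<close> leaves the count of ones unchanged, which forces any limit
  frequency to be \<open>0\<close>; doubling \<open>n = 4 ^ m\<close> adds a positive proportion of ones.\<close>

lemma ones_frequency_diverges: "\<not> (\<lambda>n. real (c 1 n) / real n) \<longlonglongrightarrow> v"
proof
  assume lim: "(\<lambda>n. real (c 1 n) / real n) \<longlonglongrightarrow> v"
  have mono2: "strict_mono (\<lambda>m. 2 * 4 ^ m :: nat)" and mono4: "strict_mono (\<lambda>m. 4 * 4 ^ m :: nat)"
    by (auto intro!: strict_monoI_Suc)
  have lim2: "(\<lambda>m. real (c 1 (2 * 4 ^ m)) / real (2 * 4 ^ m)) \<longlonglongrightarrow> v"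
    using LIMSEQ_subseq_LIMSEQ[OF lim mono2] by (simp add: o_def)
  have lim4: "(\<lambda>m. real (c 1 (4 * 4 ^ m)) / real (4 * 4 ^ m)) \<longlonglongrightarrow> v"
    using LIMSEQ_subseq_LIMSEQ[OF lim mono4] by (simp add: o_def)
  have gap: "\<not> ones_phase j" if "2 * 4 ^ m < j" "j \<le> 4 * 4 ^ m" for j m
  proof
    assume "ones_phase j"
    then obtain k where k: "4 ^ k < j" "j \<le> 2 * 4 ^ k"
      by (auto simp: ones_phase_def)
    show False
    proof (cases "k \<le> m")
      case True
      then have "(4::nat) ^ k \<le> 4 ^ m" by (intro power_increasing) auto
      then show False using k that by linarith
    next
      case False
      then have "(4::nat) ^ Suc m \<le> 4 ^ k" by (intro power_increasing) auto
      then show False using k that by simp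
    qed
  qed
  have "\<forall>\<^sub>F m in sequentially. real (c 1 (4 * 4 ^ m)) / real (4 * 4 ^ m) = real (c 1 (2 * 4 ^ m)) / real (2 * 4 ^ m) / 2"
    using eventually_ge_at_top[of N]
  proof eventually_elim
    case (elim m)
    \<comment> \<open>This places the gap beyond \<open>N\<close>, where prescribed digits are never
      1.\<close>
    have "m < 4 ^ m" by (induction m) auto
    then have "c 1 (4 * 4 ^ m) = c 1 (2 * 4 ^ m)"
      using elim gap[of m] by (intro ones_constant no_ones_outside_phase) auto
    then show ?case by simp
  qed
  then have "(\<lambda>m. real (c 1 (4 * 4 ^ m)) / real (4 * 4 ^ m)) \<longlonglongrightarrow> v / 2"
    using tendsto_divide[OF lim2 tendsto_const[of 2]] by (subst tendsto_cong) (assumption, simp)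
  then have "v = v / 2"
    by (rule LIMSEQ_unique[OF lim4])
  then have "v = 0"
    by simp
  have limF: "(\<lambda>m. real (cF (2 * 4 ^ m)) / real (2 * 4 ^ m)) \<longlonglongrightarrow> 0"
    using LIMSEQ_subseq_LIMSEQ[OF F_sparse mono2] by (simp add: o_def)
  have lim_const: "(\<lambda>m. 4 / real (2 * 4 ^ m)) \<longlonglongrightarrow> 0"
    by real_asymp
  have "(\<lambda>m. real (c 1 (2 * 4 ^ m)) / real (2 * 4 ^ m) + 6 * (real (cF (2 * 4 ^ m)) / real (2 * 4 ^ m))
      + 4 / real (2 * 4 ^ m)) \<longlonglongrightarrow> v + 6 * 0 + 0"
    by (intro tendsto_add tendsto_mult tendsto_const lim2 limF lim_const)
  \<comment> \<open>A phase fills the second half of the first \<open>2 * 4 ^ m\<close> positions,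
    hence the factor 1/2. In the limit this contradicts \<open>v = 0\<close>.\<close>
  moreover have "min \<theta> (2 - \<theta>) / 2 \<le> real (c 1 (2 * 4 ^ m)) / real (2 * 4 ^ m)
      + 6 * (real (cF (2 * 4 ^ m)) / real (2 * 4 ^ m)) + 4 / real (2 * 4 ^ m)" for m
  proof -
    have "min \<theta> (2 - \<theta>) * real (2 * 4 ^ m - 4 ^ m) \<le> real (c 1 (2 * 4 ^ m)) + 6 * real (cF (2 * 4 ^ m)) + 4"
      by (rule ones_lower) (auto simp: ones_phase_def)
    then have "min \<theta> (2 - \<theta>) * 4 ^ m / real (2 * 4 ^ m) \<le> (real (c 1 (2 * 4 ^ m)) + 6 * real (cF (2 * 4 ^ m)) + 4) / real (2 * 4 ^ m)"
      by (intro divide_right_mono) auto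
    then show ?thesis
      by (simp add: add_divide_distrib)
  qed
  ultimately have "min \<theta> (2 - \<theta>) / 2 \<le> v + 6 * 0 + 0"
    by (intro tendsto_lowerbound[OF _ always_eventually]) auto
  then show False
    using \<open>v = 0\<close> \<theta>_pos \<theta>_less_2 by auto
qed

lemma frequency_diverges:
  assumes "i \<in> {0, 1, 2}"
  shows "\<not> (\<lambda>n. real (c i n) / real n) \<longlonglongrightarrow> v"
proof
  assume lim: "(\<lambda>n. real (c i n) / real n) \<longlonglongrightarrow> v"
  consider "i = 0" | "i = 1" | "i = 2" using assms by auto
  then show False
  proof cases
    case 1
    \<comment> \<open>Eliminating \<open>c 2\<close> from the two counting relations leaves the
      frequency of 1. The identity needs \<open>n > 0\<close>, since at 0 the quotients are 0 but
      the constant 2 remains.\<close>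
    have "(\<lambda>n. 2 - real (S n) / real n - 2 * (real (c i n) / real n)) \<longlonglongrightarrow> 2 - \<theta> - 2 * v"
      by (intro tendsto_intros lim mean_limit)
    moreover have "\<forall>\<^sub>F n in sequentially. 2 - real (S n) / real n - 2 * (real (c i n) / real n) = real (c 1 n) / real n"
      using eventually_gt_at_top[of 0]
    proof eventually_elim
      case (elim n)
      have "2 * real n - real (S n) - 2 * real (c 0 n) = real (c 1 n)"
        using count_total[of n] count_weighted[of n] by linarith
      then show ?case using elim 1 by (simp add: field_simps)
    qed
    ultimately show False
      using ones_frequency_diverges by (simp add: tendsto_cong)
  next
    case 2
    then show False using lim ones_frequency_diverges by simp
  next
    case 3
    have "(\<lambda>n. real (S n) / real n - 2 * (real (c i n) / real n)) \<longlonglongrightarrow> \<theta> - 2 * v"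
      by (intro tendsto_intros lim mean_limit)
    moreover have "real (S n) / real n - 2 * (real (c i n) / real n) = real (c 1 n) / real n" for n
    proof -
      have "real (S n) = real (c 1 n) + 2 * real (c 2 n)"
        using count_weighted[of n] by linarith
      then show ?thesis using 3 by (simp add: add_divide_distrib)
    qed
    ultimately show False
      using ones_frequency_diverges by simp
  qed
qed

section \<open>From the digit sequence to a number\<close>

lemma infinitely_many_ones: "\<exists>k\<ge>n. digit k = 1"
proof (rule ccontr)
  assume "\<not> ?thesis"
  then have "c 1 k = c 1 n" if "k \<ge> n" for k
    using that by (intro ones_constant) auto
  then have "\<forall>\<^sub>F k in sequentially. real (c 1 k) / real k = real (c 1 n) / real k"
    unfolding eventually_sequentially by metis
  moreover have "(\<lambda>k. real (c 1 n) / real k) \<longlonglongrightarrow> 0"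
    by (rule lim_const_over_n)
  ultimately have "(\<lambda>k. real (c 1 k) / real k) \<longlonglongrightarrow> 0"
    by (rule tendsto_cong[THEN iffD2])
  then show False
    using ones_frequency_diverges by blast
qed

lemma number_exists:
  obtains x where "x \<in> no_freq_mean_set \<theta>" "ternary_rep digit x" "\<And>k. 1 \<le> k \<Longrightarrow> ternary_digit x k = digit k"
proof -
  obtain x where x: "ternary_rep digit x" "x \<in> {0..1}"
    using ternary_rep_exists[OF digit_le_2] .
  \<comment> \<open>Recurring ones exclude tails of zeros and of twos, the only ones allowing a
    second representation.\<close>
  have not_const: "\<not> (\<exists>n. \<forall>k\<ge>n. digit k = d)" if "d \<noteq> 1" for d
    using infinitely_many_ones that by metis
  have digits: "ternary_digit x k = digit k" if "1 \<le> k" for k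
    by (rule ternary_digit_eqI[OF x(1) not_const not_const that]) auto
  have "digit_count i x k = c i k" for i k
    unfolding digit_count_def count_upto_def using digits by (intro arg_cong[where f = card]) auto
  moreover have "(\<Sum>i=1..n. real (ternary_digit x i)) = real (S n)" for n
    using digits by (simp add: S_eq_sum)
  ultimately have "x \<in> no_freq_mean_set \<theta>"
    unfolding no_freq_mean_set_def has_digit_frequency_def has_digit_mean_def
    using x(2) mean_limit frequency_diverges by simp
  then show thesis
    using that x(1) digits by blast
qed

end

section \<open>Prescribed prefixes and coded sets\<close>

lemma no_freq_mean_set_prefix:
  assumes \<theta>: "0 < \<theta>" "\<theta> < 2" and p: "\<And>k. p k \<le> 2"
  shows "\<exists>x\<in>no_freq_mean_set \<theta>. \<exists>a. ternary_rep a x \<and> (\<forall>k<N. a (Suc k) = p (Suc k))"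
proof -
  have "real (count_upto (\<lambda>j. j \<in> {1..N}) n) \<le> real N" for n
    unfolding count_upto_def by (rule of_nat_mono, rule order_trans[OF card_mono[of "{1..N}"]]) auto
  then have "\<forall>n. norm (real (count_upto (\<lambda>j. j \<in> {1..N}) n) / real n) \<le> real N / real n"
    by (auto intro!: divide_right_mono)
  moreover have "(\<lambda>n. real N / real n) \<longlonglongrightarrow> 0"
    by real_asymp
  ultimately have "(\<lambda>n. real (count_upto (\<lambda>j. j \<in> {1..N}) n) / real n) \<longlonglongrightarrow> 0"
    by (rule Lim_null_comparison[OF always_eventually])
  \<comment> \<open>With the threshold equal to the prefix length, the prescribed digits may include
    1.\<close>
  then interpret steered_digits \<theta> "{1..N}" p N
    by unfold_locales (use \<theta> p in auto)
  obtain x where "x \<in> no_freq_mean_set \<theta>" "ternary_rep digit x"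
    by (rule number_exists) blast
  moreover have "\<forall>k<N. digit (Suc k) = p (Suc k)"
    using digit_free by simp
  ultimately show ?thesis
    by blast
qed

text \<open>Membership in \<open>X\<close> is written at the square positions as 2 or 0. Avoiding 1
  allows the threshold 0, and at most \<open>sqrt n\<close> squares up to \<open>n\<close> give
  density zero.\<close>

lemma no_freq_mean_set_code:
  assumes \<theta>: "0 < \<theta>" "\<theta> < 2"
  obtains x where "x \<in> no_freq_mean_set \<theta>" "\<And>k. ternary_digit x ((Suc k)\<^sup>2) = 2 \<longleftrightarrow> k \<in> X"
proof -
  define F where "F = range (\<lambda>k. (Suc k)\<^sup>2)"
  define p :: "nat \<Rightarrow> nat" where "p n = (if n \<in> (\<lambda>k. (Suc k)\<^sup>2) ` X then 2 else 0)" for n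
  have le: "real (count_upto (\<lambda>j. j \<in> F) n) \<le> sqrt (real n)" for n
  proof -
    have "{j \<in> {1..n}. j \<in> F} \<subseteq> (\<lambda>k. k\<^sup>2) ` {1..nat \<lfloor>sqrt (real n)\<rfloor>}"
    proof
      fix j assume "j \<in> {j \<in> {1..n}. j \<in> F}"
      then obtain k where k: "j = (Suc k)\<^sup>2" "j \<le> n" by (auto simp: F_def)
      then have "real (Suc k) \<le> sqrt (real n)"
        by (intro real_le_rsqrt) (simp del: of_nat_Suc of_nat_power add: of_nat_power[symmetric])
      then have "Suc k \<le> nat \<lfloor>sqrt (real n)\<rfloor>"
        by (simp add: le_nat_floor)
      then show "j \<in> (\<lambda>k. k\<^sup>2) ` {1..nat \<lfloor>sqrt (real n)\<rfloor>}"
        using k by auto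
    qed
    then have "count_upto (\<lambda>j. j \<in> F) n \<le> card ((\<lambda>k. k\<^sup>2) ` {1..nat \<lfloor>sqrt (real n)\<rfloor>})"
      unfolding count_upto_def by (intro card_mono) auto
    also have "\<dots> \<le> nat \<lfloor>sqrt (real n)\<rfloor>"
      using card_image_le[of "{1..nat \<lfloor>sqrt (real n)\<rfloor>}"] by simp
    finally have "real (count_upto (\<lambda>j. j \<in> F) n) \<le> real (nat \<lfloor>sqrt (real n)\<rfloor>)"
      by (rule of_nat_mono)
    also have "\<dots> \<le> sqrt (real n)"
      by (simp add: of_nat_floor)
    finally show ?thesis .
  qed
  have "\<forall>n. norm (real (count_upto (\<lambda>j. j \<in> F) n) / real n) \<le> sqrt (real n) / real n"
    using le by (auto intro!: divide_right_mono)
  moreover have "(\<lambda>n. sqrt (real n) / real n) \<longlonglongrightarrow> 0"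
    by real_asymp
  ultimately have "(\<lambda>n. real (count_upto (\<lambda>j. j \<in> F) n) / real n) \<longlonglongrightarrow> 0"
    by (rule Lim_null_comparison[OF always_eventually])
  then interpret steered_digits \<theta> F p 0
    by unfold_locales (use \<theta> in \<open>auto simp: p_def\<close>)
  obtain x where x: "x \<in> no_freq_mean_set \<theta>" "\<And>k. 1 \<le> k \<Longrightarrow> ternary_digit x k = digit k"
    by (rule number_exists) blast
  have "ternary_digit x ((Suc k)\<^sup>2) = 2 \<longleftrightarrow> k \<in> X" for k
  proof -
    have "ternary_digit x ((Suc k)\<^sup>2) = p ((Suc k)\<^sup>2)"
      using x(2) digit_free[of "(Suc k)\<^sup>2"] by (auto simp: F_def)
    then show ?thesis
      by (auto simp: p_def)
  qed
  then show thesis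
    using that x(1) by blast
qed

theorem theorem3:
  fixes \<theta> :: real
  assumes "0 < \<theta>" and "\<theta> < 2"
  shows "no_freq_mean_set \<theta> \<approx> (UNIV :: real set) \<and>
         {0..1} \<subseteq> closure (no_freq_mean_set \<theta>)"
proof
  have "\<exists>x. x \<in> no_freq_mean_set \<theta> \<and> (\<forall>k. ternary_digit x ((Suc k)\<^sup>2) = 2 \<longleftrightarrow> k \<in> X)" for X
    by (rule no_freq_mean_set_code[OF assms, of X]) blast
  then obtain f where f: "\<And>X. f X \<in> no_freq_mean_set \<theta>"
    "\<And>X k. ternary_digit (f X) ((Suc k)\<^sup>2) = 2 \<longleftrightarrow> k \<in> X"
    by metis
  have "inj f"
    by (rule injI) (metis f(2) set_eqI)
  then have "(UNIV :: nat set set) \<lesssim> no_freq_mean_set \<theta>"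
    using f(1) by (auto simp: lepoll_def)
  then have "(UNIV :: real set) \<lesssim> no_freq_mean_set \<theta>"
    using nat_sets_eqpoll_reals eqpoll_sym lepoll_trans1 by blast
  then show "no_freq_mean_set \<theta> \<approx> (UNIV :: real set)"
    by (simp add: lepoll_antisym subset_imp_lepoll)
  have "x \<in> closure (no_freq_mean_set \<theta>)" if x: "0 \<le> x" "x < 1" for x
    unfolding closure_approachable
  proof (intro allI impI)
    fix e :: real assume "0 < e"
    \<comment> \<open>Half of \<open>e\<close> is reserved for each of \<open>x\<close> and
      \<open>y\<close>, both within \<open>1 / 3 ^ n\<close> of the common truncation
      \<open>q\<close>.\<close>
    then obtain n where n: "(1 / 3) ^ n < e / 2"
      using real_arch_pow_inv[of "e / 2" "1 / 3"] by auto
    obtain p where p: "\<And>k. p k \<le> 2"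
      "\<And>n. (\<Sum>k<n. real (p (Suc k)) / 3 ^ Suc k) = \<lfloor>3 ^ n * x\<rfloor> / 3 ^ n"
      using ternary_expansion_prefix[OF x] by blast
    obtain y a where y: "y \<in> no_freq_mean_set \<theta>" "ternary_rep a y" "\<forall>k<n. a (Suc k) = p (Suc k)"
      using no_freq_mean_set_prefix[of \<theta> p n] assms p(1) by blast
    define q where "q = \<lfloor>3 ^ n * x\<rfloor> / 3 ^ n"
    have "\<bar>3 ^ n * x - \<lfloor>3 ^ n * x\<rfloor>\<bar> \<le> 1" by linarith
    then have "\<bar>3 ^ n * x - \<lfloor>3 ^ n * x\<rfloor>\<bar> / 3 ^ n \<le> 1 / 3 ^ n"
      by (intro divide_right_mono) auto
    moreover have "x - q = (3 ^ n * x - \<lfloor>3 ^ n * x\<rfloor>) / 3 ^ n"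
      by (simp add: q_def field_simps)
    ultimately have "\<bar>x - q\<bar> \<le> 1 / 3 ^ n"
      by (simp add: abs_divide)
    moreover have "\<bar>y - q\<bar> \<le> 1 / 3 ^ n"
      using ternary_prefix_dist[OF y(2), of n] y(3) p(2)[of n] by (simp add: q_def)
    ultimately have "dist y x < e"
      using n by (simp add: dist_real_def power_one_over)
    then show "\<exists>y\<in>no_freq_mean_set \<theta>. dist y x < e"
      using y(1) by blast
  qed
  \<comment> \<open>The endpoint 1, not covered by the digit construction, is reached by taking
    closures.\<close>
  then have "closure {0..<1} \<subseteq> closure (no_freq_mean_set \<theta>)"
    by (intro closure_minimal) auto
  then show "{0..1} \<subseteq> closure (no_freq_mean_set \<theta>)"
    by simp
qed

end
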